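(* In the monopolist disclosure game described in the context with the rich evidence structure, i.e. $\mathcal M(t)=\{M\subseteq T: M \text{ closed and convex},\ t\in M\}$ for every $t\in T$, let the prices $(p_s)$ and the sets $M_s$, $M_\infty$ be as defined in the context. Then there exists a Pareto-improving (Perfect Bayesian) equilibrium in which the consumer's reporting strategy is $$M^*(t)=\begin{cases} M_s & \text{if } p_s<v(t)\le p_{s-1},\\ M_\infty & \text{if } t\in M_\infty.\end{cases}$$ When receiving an equilibrium disclosure of the form $M_s$, the seller charges a price of $p_s$ and sells to all types that send that message.
   Context: Pricing problem. A monopolist (seller) sells a good to one consumer with unit demand. The consumer's type $t$ is drawn from a probability measure $\mu$ with support $T$, a convex and compact subset of $\mathbb R^k$. The consumer's valuation is $v(t)$, where $v:T\to\mathbb R$ is non-negative and quasiconvex. If type $t$ buys at price $p$, her payoff is $v(t)-p$ and the seller's payoff is $p$; otherwise both get $0$. Let $F(\tilde v)=\mu(\{t\in T: v(t)\le \tilde v\})$ be the induced CDF of valuations, and let $\underline v$ and $\overline v$ be the lowest and highest valuations in the support. It is assumed that $F$ is continuous and $F(\underline v)=0$. Let $p^*$ be the lowest maximizer of $p(1-F(p))$; in the benchmark without personalized pricing the seller charges $p^*$, so type $t$'s benchmark payoff is $\max\{v(t)-p^*,0\}$. Disclosure game. The consumer observes $t$ and chooses a message $M\in\mathcal M(t)$. The seller observes only $M$ and chooses a price $p\ge0$. The consumer then decides whether to buy; she buys when indifferent. Perfect Bayesian Equilibrium: the seller's beliefs are updated by Bayes' rule whenever possible; after every message $M$ (on or off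 path) his belief is supported in $\{t\in T: M\in\mathcal M(t)\}$; and both players behave sequentially rationally. Greedy segmentation. Let $p_0=\overline v$ and, for each $s\ge1$ with $p_{s-1}>\underline v$, let $p_s$ be the lowest maximizer over $p$ of $p\,(F(p_{s-1})-F(p))$. If $p_{s'}=\underline v$ for some $s'$, the procedure halts and $S=s'$; otherwise $S=\infty$ and $p_\infty=\underline v$. For $s=1,2,\dots,S$ ($s$ finite) let $M_s=\{t\in T: v(t)\le p_{s-1}\}$, and let $M_\infty=\{t\in T: v(t)=\underline v\}$. Pareto-improving: relative to the benchmark without personalized pricing (payoff $\max\{v(t)-p^*,0\}$ for type $t$), the equilibrium improves consumer surplus for almost all consumer types without reducing the surplus of any consumer type.
   Formalization: v is assumed lower semicontinuous (otherwise M_s need not be closed) with values between the lowest and highest valuations in the support; "improves for almost all types" means no type loses and almost every type with v(t) ≤ p* gains strictly, since types above p* still pay p_1 = p*. *)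

theory Defs
  imports "HOL-Probability.Probability"
begin

definition measure_support :: "'a::topological_space measure \<Rightarrow> 'a set" where
  "measure_support \<mu> = {x. \<forall>U. open U \<and> x \<in> U \<longrightarrow> 0 < emeasure \<mu> U}"

definition quasiconvex_on :: "'a::real_vector set \<Rightarrow> ('a \<Rightarrow> real) \<Rightarrow> bool" where
  "quasiconvex_on T v \<longleftrightarrow>
     (\<forall>x\<in>T. \<forall>y\<in>T. \<forall>u\<in>{0..1}. v ((1 - u) *\<^sub>R x + u *\<^sub>R y) \<le> max (v x) (v y))"

definition valuation_cdf :: "'a measure \<Rightarrow> 'a set \<Rightarrow> ('a \<Rightarrow> real) \<Rightarrow> real \<Rightarrow> real" where
  "valuation_cdf \<mu> T v x = measure \<mu> {t \<in> T. v t \<le> x}"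

text \<open>The support of the law on the line whose distribution function is \<open>F\<close>: every
  neighbourhood of the point has positive mass.\<close>

definition cdf_support :: "(real \<Rightarrow> real) \<Rightarrow> real set" where
  "cdf_support F = {x. \<forall>e>0. F (x - e) < F (x + e)}"

definition lowest_maximizer :: "(real \<Rightarrow> real) \<Rightarrow> real" where
  "lowest_maximizer f = (LEAST p. 0 \<le> p \<and> (\<forall>q\<ge>0. f q \<le> f p))"

definition benchmark_price :: "(real \<Rightarrow> real) \<Rightarrow> real" where
  "benchmark_price F = lowest_maximizer (\<lambda>p. p * (1 - F p))"

text \<open>
  A pure assessment consists of a reporting strategy \<open>\<sigma> :: 'a \<Rightarrow> 'm\<close>, a pricing strategy
  \<open>\<pi> :: 'm \<Rightarrow> real\<close>, a purchase plan \<open>buy t m p\<close> and the seller's beliefs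
  \<open>\<beta> :: 'm \<Rightarrow> 'a measure\<close>. The set \<open>msgs t\<close> consists of the messages available to type \<open>t\<close>.
\<close>

definition consumer_payoff :: "('a \<Rightarrow> real) \<Rightarrow> 'a \<Rightarrow> real \<Rightarrow> bool \<Rightarrow> real" where
  "consumer_payoff v t p b = (if b then v t - p else 0)"

definition reporting_payoff ::
  "('a \<Rightarrow> real) \<Rightarrow> ('m \<Rightarrow> real) \<Rightarrow> ('a \<Rightarrow> 'm \<Rightarrow> real \<Rightarrow> bool) \<Rightarrow> 'a \<Rightarrow> 'm \<Rightarrow> real" where
  "reporting_payoff v \<pi> buy t m = consumer_payoff v t (\<pi> m) (buy t m (\<pi> m))"

definition senders :: "'a set \<Rightarrow> ('a \<Rightarrow> 'm set) \<Rightarrow> 'm \<Rightarrow> 'a set" where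
  "senders T msgs m = {t \<in> T. m \<in> msgs t}"

definition expected_revenue ::
  "'a set \<Rightarrow> ('a \<Rightarrow> 'm set) \<Rightarrow> ('a \<Rightarrow> 'm \<Rightarrow> real \<Rightarrow> bool) \<Rightarrow> ('m \<Rightarrow> 'a measure) \<Rightarrow> 'm \<Rightarrow> real \<Rightarrow> real"
where
  "expected_revenue T msgs buy \<beta> m p =
     p * measure (\<beta> m) {t \<in> senders T msgs m. buy t m p}"

definition optimal_purchase ::
  "'a set \<Rightarrow> ('a \<Rightarrow> real) \<Rightarrow> ('a \<Rightarrow> 'm set) \<Rightarrow> ('a \<Rightarrow> 'm \<Rightarrow> real \<Rightarrow> bool) \<Rightarrow> bool" where
  "optimal_purchase T v msgs buy \<longleftrightarrow>
     (\<forall>t\<in>T. \<forall>m\<in>msgs t. \<forall>p\<ge>0.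
        (\<forall>b. consumer_payoff v t p b \<le> consumer_payoff v t p (buy t m p)) \<and>
        (v t = p \<longrightarrow> buy t m p))"

definition optimal_pricing ::
  "'a set \<Rightarrow> ('a \<Rightarrow> 'm set) \<Rightarrow> ('m \<Rightarrow> real) \<Rightarrow> ('a \<Rightarrow> 'm \<Rightarrow> real \<Rightarrow> bool) \<Rightarrow> ('m \<Rightarrow> 'a measure) \<Rightarrow> bool"
where
  "optimal_pricing T msgs \<pi> buy \<beta> \<longleftrightarrow>
     (\<forall>m\<in>(\<Union>t\<in>T. msgs t). 0 \<le> \<pi> m \<and>
        (\<forall>p\<ge>0. expected_revenue T msgs buy \<beta> m p \<le> expected_revenue T msgs buy \<beta> m (\<pi> m)))"

definition optimal_reporting ::
  "'a set \<Rightarrow> ('a \<Rightarrow> real) \<Rightarrow> ('a \<Rightarrow> 'm set) \<Rightarrow> ('a \<Rightarrow> 'm) \<Rightarrow> ('m \<Rightarrow> real) \<Rightarrow>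
   ('a \<Rightarrow> 'm \<Rightarrow> real \<Rightarrow> bool) \<Rightarrow> bool" where
  "optimal_reporting T v msgs \<sigma> \<pi> buy \<longleftrightarrow>
     (\<forall>t\<in>T. \<sigma> t \<in> msgs t \<and>
        (\<forall>m\<in>msgs t. reporting_payoff v \<pi> buy t m \<le> reporting_payoff v \<pi> buy t (\<sigma> t)))"

definition beliefs_respect_evidence ::
  "'a measure \<Rightarrow> 'a set \<Rightarrow> ('a \<Rightarrow> 'm set) \<Rightarrow> ('m \<Rightarrow> 'a measure) \<Rightarrow> bool" where
  "beliefs_respect_evidence \<mu> T msgs \<beta> \<longleftrightarrow>
     (\<forall>m\<in>(\<Union>t\<in>T. msgs t). prob_space (\<beta> m) \<and> sets (\<beta> m) = sets \<mu> \<and>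
        (AE t in \<beta> m. t \<in> senders T msgs m))"

text \<open>
  A message sent with positive probability is followed by the conditional distribution of \<open>\<mu>\<close>
  given the types that send it. A message that is sent, but only by a null set of types, is
  still followed by a belief concentrated on those types.
\<close>

definition beliefs_bayesian ::
  "'a measure \<Rightarrow> 'a set \<Rightarrow> ('a \<Rightarrow> 'm) \<Rightarrow> ('m \<Rightarrow> 'a measure) \<Rightarrow> bool" where
  "beliefs_bayesian \<mu> T \<sigma> \<beta> \<longleftrightarrow>
     (\<forall>m\<in>\<sigma> ` T.
        (AE t in \<beta> m. t \<in> T \<and> \<sigma> t = m) \<and>
        (0 < measure \<mu> {t \<in> T. \<sigma> t = m} \<longrightarrow>
           (\<forall>A\<in>sets \<mu>. measure (\<beta> m) A =
              measure \<mu> (A \<inter> {t \<in> T. \<sigma> t = m}) / measure \<mu> {t \<in> T. \<sigma> t = m})))"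

definition perfect_bayesian_equilibrium ::
  "'a measure \<Rightarrow> 'a set \<Rightarrow> ('a \<Rightarrow> real) \<Rightarrow> ('a \<Rightarrow> 'm set) \<Rightarrow> ('a \<Rightarrow> 'm) \<Rightarrow> ('m \<Rightarrow> real) \<Rightarrow>
   ('a \<Rightarrow> 'm \<Rightarrow> real \<Rightarrow> bool) \<Rightarrow> ('m \<Rightarrow> 'a measure) \<Rightarrow> bool" where
  "perfect_bayesian_equilibrium \<mu> T v msgs \<sigma> \<pi> buy \<beta> \<longleftrightarrow>
     optimal_reporting T v msgs \<sigma> \<pi> buy \<and>
     optimal_pricing T msgs \<pi> buy \<beta> \<and>
     optimal_purchase T v msgs buy \<and>
     beliefs_respect_evidence \<mu> T msgs \<beta> \<and>
     beliefs_bayesian \<mu> T \<sigma> \<beta>"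

definition rich_evidence :: "'a::euclidean_space set \<Rightarrow> 'a \<Rightarrow> 'a set set" where
  "rich_evidence T t = {M. M \<subseteq> T \<and> closed M \<and> convex M \<and> t \<in> M}"

text \<open>
  No type loses, and almost every type gains strictly unless it already enjoys a positive
  surplus at the benchmark price \<open>p\<close>. The exception cannot be dropped for the greedy
  segmentation: its top segment is charged exactly the benchmark price, so the (non-null set of)
  types with \<open>v t > p\<close> obtain exactly their benchmark surplus.
\<close>

definition pareto_improving ::
  "'a measure \<Rightarrow> 'a set \<Rightarrow> ('a \<Rightarrow> real) \<Rightarrow> real \<Rightarrow> ('a \<Rightarrow> real) \<Rightarrow> bool" where
  "pareto_improving \<mu> T v p U \<longleftrightarrow>
     (\<forall>t\<in>T. max (v t - p) 0 \<le> U t) \<and>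
     (AE t in \<mu>. t \<in> T \<longrightarrow> max (v t - p) 0 < U t \<or> 0 < max (v t - p) 0)"

text \<open>
  \<open>greedy_seq F vlo vhi s\<close> is the price \<open>p\<^sub>s\<close> for finite \<open>s\<close>. Once the sequence has
  reached \<open>vlo\<close> it stays there; only indices up to \<open>greedy_last\<close> are used below.
\<close>

primrec greedy_seq :: "(real \<Rightarrow> real) \<Rightarrow> real \<Rightarrow> real \<Rightarrow> nat \<Rightarrow> real" where
  "greedy_seq F vlo vhi 0 = vhi"
| "greedy_seq F vlo vhi (Suc s) =
     (let q = greedy_seq F vlo vhi s
      in if q > vlo then lowest_maximizer (\<lambda>p. p * (F q - F p)) else q)"

text \<open>The infimum of the empty set is \<open>\<infinity>\<close>, the case in which the procedure does not halt.\<close>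

definition greedy_last :: "(real \<Rightarrow> real) \<Rightarrow> real \<Rightarrow> real \<Rightarrow> enat" where
  "greedy_last F vlo vhi = Inf (enat ` {s. greedy_seq F vlo vhi s = vlo})"

definition greedy_indices :: "(real \<Rightarrow> real) \<Rightarrow> real \<Rightarrow> real \<Rightarrow> enat set" where
  "greedy_indices F vlo vhi = {s. 1 \<le> s \<and> s \<le> greedy_last F vlo vhi} \<union> {\<infinity>}"

definition greedy_price :: "(real \<Rightarrow> real) \<Rightarrow> real \<Rightarrow> real \<Rightarrow> enat \<Rightarrow> real" where
  "greedy_price F vlo vhi s = (case s of enat n \<Rightarrow> greedy_seq F vlo vhi n | \<infinity> \<Rightarrow> vlo)"

definition greedy_message ::
  "'a set \<Rightarrow> ('a \<Rightarrow> real) \<Rightarrow> (real \<Rightarrow> real) \<Rightarrow> real \<Rightarrow> real \<Rightarrow> enat \<Rightarrow> 'a set" where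
  "greedy_message T v F vlo vhi s =
     (case s of
        enat n \<Rightarrow> {t \<in> T. v t \<le> greedy_seq F vlo vhi (n - 1)}
      | \<infinity> \<Rightarrow> {t \<in> T. v t = vlo})"

definition greedy_segment ::
  "'a set \<Rightarrow> ('a \<Rightarrow> real) \<Rightarrow> (real \<Rightarrow> real) \<Rightarrow> real \<Rightarrow> real \<Rightarrow> enat \<Rightarrow> 'a set" where
  "greedy_segment T v F vlo vhi s =
     (case s of
        enat n \<Rightarrow> {t \<in> T. greedy_seq F vlo vhi n < v t \<and> v t \<le> greedy_seq F vlo vhi (n - 1)}
      | \<infinity> \<Rightarrow> {t \<in> T. v t = vlo})"

text \<open>
  The segments partition the type space, so that the case distinction
  defining the strategy is exhaustive and unambiguous, and every type sends the message of its
  segment.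
\<close>

definition greedy_reporting ::
  "'a set \<Rightarrow> ('a \<Rightarrow> real) \<Rightarrow> (real \<Rightarrow> real) \<Rightarrow> real \<Rightarrow> real \<Rightarrow> ('a \<Rightarrow> 'a set) \<Rightarrow> bool" where
  "greedy_reporting T v F vlo vhi \<sigma> \<longleftrightarrow>
     (\<forall>t\<in>T. \<exists>!s. s \<in> greedy_indices F vlo vhi \<and> t \<in> greedy_segment T v F vlo vhi s) \<and>
     (\<forall>s\<in>greedy_indices F vlo vhi. \<forall>t\<in>greedy_segment T v F vlo vhi s.
        \<sigma> t = greedy_message T v F vlo vhi s)"

end

(* Every type t pays the price w(t) of its greedy segment, and w(t) <= v(t). On the path, p_s is
   optimal against the conditional distribution on (p_s, p_{s-1}] because it maximizes
   p (F(p_{s-1}) - F(p)). A message available to t is never followed by a price below w(t): prices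
   fall along the segments, t cannot join a lower segment's message, and an off-path message is met
   with a point belief on a type in the highest segment that meets it. The greedy prices converge
   to the lowest valuation, since at a limit L above it the revenue from a segment would tend to 0,
   whereas a fixed price below L earns a positive amount on every segment. *)

theory Submission
  imports Defs
begin

section \<open>Lowest maximizers, supports and convex sublevel sets\<close>

text \<open>\<open>LEAST\<close> on the reals is meaningful only if a least maximizer exists.
  Continuity makes the maximizers over \<open>{0..b}\<close> a nonempty closed set bounded below, so
  it contains its infimum; beyond \<open>b\<close> values never exceed \<open>f b\<close>, so the
  maximum is global.\<close>

lemma lowest_maximizer_maximizes:
  fixes f :: "real \<Rightarrow> real"
  assumes cont: "continuous_on {0..b} f" and "0 \<le> b" and above: "\<And>p. b < p \<Longrightarrow> f p \<le> f b"
  shows "0 \<le> lowest_maximizer f" and "\<And>q. 0 \<le> q \<Longrightarrow> f q \<le> f (lowest_maximizer f)"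
proof -
  obtain x where x: "x \<in> {0..b}" "\<And>y. y \<in> {0..b} \<Longrightarrow> f y \<le> f x"
    using continuous_attains_sup[of "{0..b}" f] cont \<open>0 \<le> b\<close> by auto
  define A where "A = {y \<in> {0..b}. f x \<le> f y}"
  have "closed A"
    unfolding A_def by (intro continuous_on_closed_Collect_le continuous_on_const cont) auto
  moreover have "x \<in> A" "bdd_below A"
    using x by (auto simp: A_def)
  ultimately have Inf: "Inf A \<in> A"
    using closed_contains_Inf by blast
  have max: "f q \<le> f x" if "0 \<le> q" for q
    using that x(2)[of q] x(2)[of b] above[of q] \<open>0 \<le> b\<close> by (cases "q \<le> b") auto
  have "lowest_maximizer f = Inf A"
    unfolding lowest_maximizer_def
  proof (rule Least_equality)
    show "0 \<le> Inf A \<and> (\<forall>q\<ge>0. f q \<le> f (Inf A))"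
      using Inf max order_trans by (fastforce simp: A_def)
  next
    fix y assume y: "0 \<le> y \<and> (\<forall>q\<ge>0. f q \<le> f y)"
    show "Inf A \<le> y"
    proof (cases "y \<le> b")
      case True
      then have "y \<in> A"
        using y x(1) by (auto simp: A_def)
      then show ?thesis
        using \<open>bdd_below A\<close> by (rule cInf_lower)
    next
      case False
      then show ?thesis
        using Inf by (auto simp: A_def)
    qed
  qed
  then show "0 \<le> lowest_maximizer f" and "\<And>q. 0 \<le> q \<Longrightarrow> f q \<le> f (lowest_maximizer f)"
    using Inf max order_trans by (fastforce simp: A_def)+
qed

text \<open>The complement is the union of all open null sets, and by second countability countably
  many of them have the same union.\<close>

lemma null_set_Compl_measure_support:
  fixes \<mu> :: "'a::second_countable_topology measure"
  assumes "sets \<mu> = sets borel"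
  shows "- measure_support \<mu> \<in> null_sets \<mu>"
proof -
  define \<U> where "\<U> = {U. open U \<and> emeasure \<mu> U = 0}"
  obtain \<V> where \<V>: "\<V> \<subseteq> \<U>" "countable \<V>" "\<Union>\<V> = \<Union>\<U>"
    using Lindelof[of \<U>] by (auto simp: \<U>_def)
  have "- measure_support \<mu> = \<Union>\<U>"
    by (auto simp: measure_support_def \<U>_def zero_less_iff_neq_zero)
  moreover have "(\<Union>U\<in>\<V>. U) \<in> null_sets \<mu>"
    using \<V>(1,2) assms by (intro null_sets_UN') (auto simp: \<U>_def null_sets_def)
  ultimately show ?thesis
    using \<V>(3) by simp
qed

lemma quasiconvex_on_convex_sublevel:
  assumes "quasiconvex_on T v" and "convex T"
  shows "convex {t \<in> T. v t \<le> c}"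
  unfolding convex_alt
proof (intro ballI allI impI)
  fix x y u
  assume *: "x \<in> {t \<in> T. v t \<le> c}" "y \<in> {t \<in> T. v t \<le> c}" "0 \<le> u \<and> u \<le> (1::real)"
  then have "(1 - u) *\<^sub>R x + u *\<^sub>R y \<in> T"
    using \<open>convex T\<close> unfolding convex_alt by blast
  moreover have "v ((1 - u) *\<^sub>R x + u *\<^sub>R y) \<le> max (v x) (v y)"
    using assms(1) * unfolding quasiconvex_on_def by simp
  ultimately show "(1 - u) *\<^sub>R x + u *\<^sub>R y \<in> {t \<in> T. v t \<le> c}"
    using * by auto
qed

declare greedy_seq.simps(2) [simp del]

section \<open>The greedy price sequence, in terms of the valuation CDF alone\<close>

locale greedy_cdf =
  fixes F :: "real \<Rightarrow> real" and vlo vhi :: real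
  assumes F_mono: "mono F"
    and F_cont: "continuous_on UNIV F"
    and F_vlo: "F vlo = 0"
    and F_pos: "\<And>x. vlo < x \<Longrightarrow> 0 < F x"
    and F_nonneg: "\<And>x. 0 \<le> F x"
    and vlo_nonneg: "0 \<le> vlo"
    and vlo_less_vhi: "vlo < vhi"
begin

abbreviation p :: "nat \<Rightarrow> real" where "p \<equiv> greedy_seq F vlo vhi"
abbreviation I :: "enat set" where "I \<equiv> greedy_indices F vlo vhi"
abbreviation price :: "enat \<Rightarrow> real" where "price \<equiv> greedy_price F vlo vhi"

lemma F_below: "x \<le> vlo \<Longrightarrow> F x = 0"
  using monoD[OF F_mono, of x vlo] F_vlo F_nonneg[of x] by simp

text \<open>The price \<open>vlo\<close> itself may be 0 and earn nothing. Since \<open>F\<close> is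
  continuous with \<open>F vlo = 0\<close>, a price slightly above \<open>vlo\<close> is positive
  and still leaves mass between it and \<open>q\<close>.\<close>

lemma exists_positive_revenue:
  assumes "vlo < q"
  shows "\<exists>x. vlo \<le> x \<and> 0 < x * (F q - F x)"
proof -
  have "isCont F vlo"
    using F_cont continuous_on_eq_continuous_at by blast
  then have "(F \<longlongrightarrow> 0) (at_right vlo)"
    using F_vlo by (auto simp: isCont_def intro: tendsto_within_subset)
  then have "eventually (\<lambda>x. F x < F q) (at_right vlo)"
    using F_pos[OF assms] order_tendstoD(2) by blast
  moreover have "eventually (\<lambda>x. vlo < x) (at_right vlo)"
    by (simp add: eventually_at_right_less)
  ultimately have "eventually (\<lambda>x. F x < F q \<and> vlo < x) (at_right vlo)"
    by eventually_elim simp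
  then obtain x where "F x < F q" "vlo < x"
    using eventually_happens' trivial_limit_at_right_real by blast
  then show ?thesis
    using vlo_nonneg by (intro exI[of _ x]) auto
qed

text \<open>One round of the procedure. The maximal revenue is positive, which forces the maximizer
  strictly below \<open>q\<close> with positive mass in between.\<close>

lemma greedy_step:
  assumes "vlo < q" and m: "m = lowest_maximizer (\<lambda>x. x * (F q - F x))"
  shows "vlo \<le> m" and "m < q" and "F m < F q"
    and "\<And>x. 0 \<le> x \<Longrightarrow> x * (F q - F x) \<le> m * (F q - F m)"
proof -
  have q: "0 \<le> q"
    using assms(1) vlo_nonneg by simp
  have cont: "continuous_on {0..q} (\<lambda>x. x * (F q - F x))"
    by (intro continuous_intros continuous_on_subset[OF F_cont]) auto
  \<comment> \<open>Beyond \<open>q\<close> the factor \<open>F q - F x\<close> is nonpositive, so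
    the search for a maximizer can be confined to \<open>{0..q}\<close>.\<close>
  have above: "x * (F q - F x) \<le> q * (F q - F q)" if "q < x" for x
    using that q monoD[OF F_mono, of q x] by (simp add: mult_nonneg_nonpos)
  note max = lowest_maximizer_maximizes[OF cont q above, folded m]
  show le: "\<And>x. 0 \<le> x \<Longrightarrow> x * (F q - F x) \<le> m * (F q - F m)"
    by (rule max(2))
  obtain x where "vlo \<le> x" "0 < x * (F q - F x)"
    using exists_positive_revenue[OF assms(1)] by blast
  then have pos: "0 < m * (F q - F m)"
    using le[of x] vlo_nonneg by simp
  then show F: "F m < F q"
    using max(1) by (auto simp: zero_less_mult_iff)
  then show "m < q"
    using monoD[OF F_mono, of q m] by (meson not_le)
  show "vlo \<le> m"
  proof (rule ccontr)
    assume "\<not> vlo \<le> m"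
    \<comment> \<open>Below \<open>vlo\<close> the CDF is 0, so \<open>vlo\<close> sells to the same
      mass \<open>F q\<close> at a higher price.\<close>
    then have "m * F q < vlo * F q"
      using F_pos[OF assms(1)] by simp
    then show False
      using le[OF vlo_nonneg] F_below[of m] \<open>\<not> vlo \<le> m\<close> F_vlo by simp
  qed
qed

lemma p_Suc: "vlo < p k \<Longrightarrow> p (Suc k) = lowest_maximizer (\<lambda>x. x * (F (p k) - F x))"
  by (simp add: greedy_seq.simps(2))

lemma p_Suc_step:
  assumes "vlo < p k"
  shows "vlo \<le> p (Suc k)" and "p (Suc k) < p k" and "F (p (Suc k)) < F (p k)"
    and "\<And>x. 0 \<le> x \<Longrightarrow> x * (F (p k) - F x) \<le> p (Suc k) * (F (p k) - F (p (Suc k)))"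
  using greedy_step[OF assms p_Suc[OF assms]] by blast+

lemma p_Suc_halted: "\<not> vlo < p k \<Longrightarrow> p (Suc k) = p k"
  by (simp add: greedy_seq.simps(2))

lemma p_ge: "vlo \<le> p k"
proof (induction k)
  case 0
  then show ?case
    using vlo_less_vhi by simp
next
  case (Suc k)
  show ?case
  proof (cases "vlo < p k")
    case True
    then show ?thesis
      using p_Suc_step(1) by blast
  next
    case False
    then show ?thesis
      using Suc p_Suc_halted by simp
  qed
qed

lemma p_Suc_le: "p (Suc k) \<le> p k"
proof (cases "vlo < p k")
  case True
  then show ?thesis
    using p_Suc_step(2) less_imp_le by blast
qed (simp add: p_Suc_halted)

lemma p_decseq: "decseq p"
  using p_Suc_le by (rule decseq_SucI)

lemma p_antimono: "j \<le> k \<Longrightarrow> p k \<le> p j"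
  using p_decseq by (simp add: decseqD)

text \<open>Halting or not, the argument is the same, since a limit above \<open>vlo\<close> keeps
  every price above \<open>vlo\<close>. Convergence puts each valuation above \<open>vlo\<close>
  into a finite segment.\<close>

lemma p_tendsto: "p \<longlonglongrightarrow> vlo"
proof -
  obtain L where L: "p \<longlonglongrightarrow> L" "\<And>k. L \<le> p k"
    using decseq_convergent[OF p_decseq] p_ge by blast
  have "vlo \<le> L"
    using L(1) p_ge by (meson LIMSEQ_le_const)
  moreover have "\<not> vlo < L"
  proof
    assume "vlo < L"
    \<comment> \<open>\<open>x\<close> is chosen for the limit \<open>L\<close>, so that one fixed
      price competes with every \<open>p (Suc k)\<close>.\<close>
    then obtain x where x: "vlo \<le> x" "0 < x * (F L - F x)"
      using exists_positive_revenue by blast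
    have F: "(\<lambda>k. F (p k)) \<longlonglongrightarrow> F L"
      using F_cont L(1) continuous_on_eq_continuous_at isCont_tendsto_compose by blast
    have "x * (F (p k) - F x) \<le> p (Suc k) * (F (p k) - F (p (Suc k)))" for k
      using p_Suc_step(4)[of k x] L(2)[of k] \<open>vlo < L\<close> x(1) vlo_nonneg by simp
    moreover have "(\<lambda>k. x * (F (p k) - F x)) \<longlonglongrightarrow> x * (F L - F x)"
      by (intro tendsto_intros F)
    \<comment> \<open>Both \<open>p k\<close> and \<open>p (Suc k)\<close> tend to \<open>L\<close>,
      so the segment masses vanish.\<close>
    moreover have "(\<lambda>k. p (Suc k) * (F (p k) - F (p (Suc k)))) \<longlonglongrightarrow> L * (F L - F L)"
      by (intro tendsto_intros F LIMSEQ_Suc[OF F] LIMSEQ_Suc[OF L(1)])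
    ultimately have "x * (F L - F x) \<le> L * (F L - F L)"
      by (intro LIMSEQ_le) auto
    then show False
      using x(2) by simp
  qed
  ultimately show ?thesis
    using L(1) by simp
qed

text \<open>Replaces the infimum over halting rounds by a condition on one price: prices never rise
  and never fall below \<open>vlo\<close>, so no halt has occurred up to \<open>k\<close> iff
  \<open>p k\<close> is above \<open>vlo\<close>.\<close>

lemma enat_in_I: "enat n \<in> I \<longleftrightarrow> (\<exists>k. n = Suc k \<and> vlo < p k)"
proof -
  have "enat n \<le> greedy_last F vlo vhi \<longleftrightarrow> (\<forall>s. p s = vlo \<longrightarrow> n \<le> s)"
    by (auto simp: greedy_last_def le_Inf_iff)
  also have "1 \<le> n \<and> \<dots> \<longleftrightarrow> (\<exists>k. n = Suc k \<and> vlo < p k)"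
  proof (intro iffI; elim conjE exE)
    assume *: "1 \<le> n" "\<forall>s. p s = vlo \<longrightarrow> n \<le> s"
    then have "p (n - 1) \<noteq> vlo"
      by fastforce
    then show "\<exists>k. n = Suc k \<and> vlo < p k"
      using *(1) p_ge[of "n - 1"] by (intro exI[of _ "n - 1"]) auto
  next
    fix k assume k: "n = Suc k" "vlo < p k"
    have "n \<le> s" if "p s = vlo" for s
      using that k p_antimono[of s k] by (auto simp: Suc_le_eq not_less[symmetric])
    then show "1 \<le> n \<and> (\<forall>s. p s = vlo \<longrightarrow> n \<le> s)"
      using k by simp
  qed
  finally show ?thesis
    by (auto simp: greedy_indices_def one_enat_def)
qed

lemma I_cases:
  assumes "s \<in> I"
  obtains (infinite) "s = \<infinity>" | (finite) k where "s = enat (Suc k)" "vlo < p k"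
  using assms enat_in_I by (cases s) auto

lemma infinity_in_I: "\<infinity> \<in> I"
  by (simp add: greedy_indices_def)

lemma price_simps [simp]: "price (enat k) = p k" "price \<infinity> = vlo"
  by (simp_all add: greedy_price_def)

lemma price_antimono: "s \<le> s' \<Longrightarrow> price s' \<le> price s"
  using p_ge p_antimono by (cases s; cases s') auto

lemma price_ge: "vlo \<le> price s"
  using p_ge by (cases s) auto

end

section \<open>The disclosure game: measures of valuation intervals\<close>

locale disclosure_game = greedy_cdf F vlo vhi
  for F :: "real \<Rightarrow> real" and vlo vhi :: real +
  fixes T :: "'a::euclidean_space set" and \<mu> :: "'a measure" and v :: "'a \<Rightarrow> real"
  assumes prob: "prob_space \<mu>"
    and sets_mu: "sets \<mu> = sets borel"
    and AE_T: "AE t in \<mu>. t \<in> T"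
    and closed_sublevel: "\<And>c. closed {t \<in> T. v t \<le> c}"
    and convex_sublevel: "\<And>c. convex {t \<in> T. v t \<le> c}"
    and F_eq: "F = valuation_cdf \<mu> T v"
    and v_bounds: "\<And>t. t \<in> T \<Longrightarrow> vlo \<le> v t \<and> v t \<le> vhi"
begin

interpretation prob_space \<mu>
  by (rule prob)

abbreviation Msg :: "enat \<Rightarrow> 'a set" where "Msg \<equiv> greedy_message T v F vlo vhi"
abbreviation Seg :: "enat \<Rightarrow> 'a set" where "Seg \<equiv> greedy_segment T v F vlo vhi"
abbreviation msgs :: "'a \<Rightarrow> 'a set set" where "msgs \<equiv> rich_evidence T"

lemma space_mu [simp]: "space \<mu> = UNIV"
  using sets_eq_imp_space_eq[OF sets_mu] by simp

lemma sublevel_sets [measurable]: "{t \<in> T. v t \<le> c} \<in> sets \<mu>"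
  using closed_sublevel sets_mu by (simp add: borel_closed)

lemma measure_sublevel: "measure \<mu> {t \<in> T. v t \<le> c} = F c"
  by (simp add: F_eq valuation_cdf_def)

lemma measure_interval:
  assumes "x \<le> y"
  shows "{t \<in> T. x < v t \<and> v t \<le> y} \<in> sets \<mu>"
    and "measure \<mu> {t \<in> T. x < v t \<and> v t \<le> y} = F y - F x"
proof -
  have eq: "{t \<in> T. x < v t \<and> v t \<le> y} = {t \<in> T. v t \<le> y} - {t \<in> T. v t \<le> x}"
    by auto
  show "{t \<in> T. x < v t \<and> v t \<le> y} \<in> sets \<mu>"
    unfolding eq by measurable
  show "measure \<mu> {t \<in> T. x < v t \<and> v t \<le> y} = F y - F x"
    unfolding eq using assms by (subst finite_measure_Diff) (auto simp: measure_sublevel)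
qed

text \<open>Indifferent types buy, so demand at price \<open>x\<close> includes valuations equal to
  \<open>x\<close>. Half-open intervals starting at \<open>z < x\<close> bound it, and continuity of
  \<open>F\<close> allows \<open>z\<close> to rise to \<open>x\<close>.\<close>

lemma measure_interval_closed_le:
  assumes "x \<le> y"
  shows "measure \<mu> {t \<in> T. x \<le> v t \<and> v t \<le> y} \<le> F y - F x"
proof -
  have le: "measure \<mu> {t \<in> T. x \<le> v t \<and> v t \<le> y} \<le> F y - F z" if "z < x" for z
  proof -
    have "measure \<mu> {t \<in> T. x \<le> v t \<and> v t \<le> y} \<le> measure \<mu> {t \<in> T. z < v t \<and> v t \<le> y}"
      using that assms by (intro finite_measure_mono measure_interval) auto
    then show ?thesis
      using that assms measure_interval(2)[of z y] by simp
  qed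
  have "isCont F x"
    using F_cont continuous_on_eq_continuous_at by blast
  then have "((\<lambda>z. F y - F z) \<longlongrightarrow> F y - F x) (at_left x)"
    by (intro tendsto_intros) (auto simp: isCont_def intro: tendsto_within_subset)
  then show ?thesis
    by (rule tendsto_lowerbound) (auto simp: eventually_at_filter le)
qed

section \<open>Messages, segments and the partition of the types\<close>

lemma Msg_simps [simp]:
  "Msg (enat (Suc k)) = {t \<in> T. v t \<le> p k}"
  "Msg \<infinity> = {t \<in> T. v t = vlo}"
  by (simp_all add: greedy_message_def)

lemma Seg_simps [simp]:
  "Seg (enat (Suc k)) = {t \<in> T. p (Suc k) < v t \<and> v t \<le> p k}"
  "Seg \<infinity> = {t \<in> T. v t = vlo}"
  by (simp_all add: greedy_segment_def)

text \<open>Gives \<open>Msg \<infinity>\<close> the closedness, convexity and measure known for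
  sublevel sets, as \<open>vlo\<close> bounds all valuations from below.\<close>

lemma Msg_infinity_sublevel: "Msg \<infinity> = {t \<in> T. v t \<le> vlo}"
  using v_bounds by force

lemma Msg_closed_convex:
  assumes "s \<in> I"
  shows "Msg s \<subseteq> T" "closed (Msg s)" "convex (Msg s)"
proof -
  obtain c where "Msg s = {t \<in> T. v t \<le> c}"
    using Msg_infinity_sublevel Msg_simps(1) assms by (metis I_cases)
  then show "Msg s \<subseteq> T" "closed (Msg s)" "convex (Msg s)"
    using closed_sublevel convex_sublevel by auto
qed

lemma Seg_subset_Msg: "s \<in> I \<Longrightarrow> Seg s \<subseteq> Msg s"
  by (auto elim!: I_cases)

lemma Seg_null: "Seg \<infinity> \<in> null_sets \<mu>"
  using Msg_infinity_sublevel measure_sublevel[of vlo] sublevel_sets[of vlo] F_vlo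
  by (simp add: null_sets_def emeasure_eq_measure)

lemma price_le_valuation: "s \<in> I \<Longrightarrow> t \<in> Seg s \<Longrightarrow> price s \<le> v t"
  by (auto elim!: I_cases)

text \<open>On-path incentives: a type of segment \<open>Suc k\<close> has a valuation above
  \<open>p (Suc k)\<close>, which excludes it from the messages of all later segments. The greedy
  messages left to it carry prices at least as high as its own.\<close>

lemma Seg_Msg_price_le:
  assumes "s \<in> I" "s' \<in> I" "t \<in> Seg s" "t \<in> Msg s'"
  shows "price s \<le> price s'"
  using assms(1)
proof (cases rule: I_cases)
  case infinite
  then show ?thesis
    using price_ge by simp
next
  case (finite k)
  note s = this
  from assms(2) show ?thesis
  proof (cases rule: I_cases)
    case infinite
    then show ?thesis
      using s assms(3,4) p_ge[of "Suc k"] by simp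
  next
    case (finite j)
    then have "\<not> Suc k \<le> j"
      using s assms(3,4) p_antimono[of "Suc k" j] by auto
    then show ?thesis
      using s finite p_antimono[of "Suc j" "Suc k"] by simp
  qed
qed

text \<open>Prices tend to \<open>vlo\<close>, so a valuation above \<open>vlo\<close> is eventually
  undercut; the first price below it is the lower end of its segment.\<close>

lemma exists_Seg:
  assumes "t \<in> T"
  shows "\<exists>s\<in>I. t \<in> Seg s"
proof (cases "v t = vlo")
  case True
  then show ?thesis
    using assms infinity_in_I by (intro bexI[of _ "\<infinity>"]) auto
next
  case False
  then have "vlo < v t"
    using v_bounds[OF assms] by simp
  then have ex: "\<exists>n. p n < v t"
    using order_tendstoD(2)[OF p_tendsto] eventually_happens' sequentially_bot by blast
  define n where "n = (LEAST n. p n < v t)"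
  have n: "p n < v t"
    unfolding n_def using ex by (rule LeastI_ex)
  have below: "\<not> p k < v t" if "k < n" for k
    using that not_less_Least unfolding n_def by blast
  \<comment> \<open>The index is not 0, since \<open>p 0 = vhi\<close> is at least
    \<open>v t\<close>.\<close>
  obtain k where k: "n = Suc k"
    using n v_bounds[OF assms] by (cases n) auto
  then have "v t \<le> p k"
    using below[of k] by simp
  then have "enat (Suc k) \<in> I" "t \<in> Seg (enat (Suc k))"
    using n k assms \<open>vlo < v t\<close> by (auto simp: enat_in_I)
  then show ?thesis ..
qed

lemma F_p_strict: "vlo < p k \<Longrightarrow> k < j \<Longrightarrow> F (p j) < F (p k)"
  using p_Suc_step(3)[of k] p_antimono[of "Suc k" j] monoD[OF F_mono, of "p j" "p (Suc k)"]
  by simp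

text \<open>Lets the seller read the segment off the message. Messages are told apart by their
  measures: \<open>F (p k)\<close> falls strictly while \<open>p k\<close> is above
  \<open>vlo\<close>, and \<open>Msg \<infinity>\<close> is null while the others are not.\<close>

lemma Msg_inj: "inj_on Msg I"
proof -
  have "s = s'" if "s \<in> I" "s' \<in> I" "s \<le> s'" "measure \<mu> (Msg s) = measure \<mu> (Msg s')" for s s'
    using that(1)
  proof (cases rule: I_cases)
    case infinite
    then show ?thesis
      using that(3) by simp
  next
    case (finite k)
    note s = this
    from that(2) show ?thesis
    proof (cases rule: I_cases)
      case infinite
      then show ?thesis
        using that(4) s F_pos[of "p k"] Msg_infinity_sublevel
        by (simp add: measure_sublevel F_vlo del: Msg_simps(2))
    next
      case (finite j)
      then show ?thesis
        using that(3,4) s F_p_strict[of k j] by (force simp: measure_sublevel)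
    qed
  qed
  then show ?thesis
    by (metis inj_onI linear)
qed

text \<open>A segment lies in its own message, so two segments sharing a type have equal prices by
  \<open>Seg_Msg_price_le\<close> in both directions. Distinct finite segments have distinct prices,
  and they hold only valuations above \<open>vlo\<close>, unlike the infinite one.\<close>

lemma ex1_Seg:
  assumes "t \<in> T"
  shows "\<exists>!s. s \<in> I \<and> t \<in> Seg s"
proof -
  have "s = s'" if "s \<in> I" "s' \<in> I" "t \<in> Seg s" "t \<in> Seg s'" for s s'
  proof -
    have eq: "price s = price s'"
      using that Seg_Msg_price_le[of s s' t] Seg_Msg_price_le[of s' s t] Seg_subset_Msg
      by (meson antisym subsetD)
    show ?thesis
      using that(1)
    proof (cases rule: I_cases)
      case infinite
      with that(2,4) show ?thesis
        using that(3) p_ge by (cases rule: I_cases) (auto simp: not_less[symmetric])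
    next
      case (finite k)
      note s = this
      from that(2) show ?thesis
      proof (cases rule: I_cases)
        case infinite
        then show ?thesis
          using that(3,4) s p_ge[of "Suc k"] by simp
      next
        case (finite j)
        then show ?thesis
          using s eq F_p_strict[of "Suc k" "Suc j"] F_p_strict[of "Suc j" "Suc k"]
            p_Suc_step(2)[of k] p_Suc_step(2)[of j] p_antimono[of "Suc k" j] p_antimono[of "Suc j" k]
          by (cases k j rule: linorder_cases) (auto)
      qed
    qed
  qed
  then show ?thesis
    using exists_Seg[OF assms] by blast
qed

section \<open>Strategies and beliefs\<close>

definition seg_of :: "'a \<Rightarrow> enat" where
  "seg_of t = (THE s. s \<in> I \<and> t \<in> Seg s)"

lemma seg_of: "t \<in> T \<Longrightarrow> seg_of t \<in> I \<and> t \<in> Seg (seg_of t)"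
  unfolding seg_of_def using ex1_Seg by (rule theI')

lemma seg_of_eq: "t \<in> T \<Longrightarrow> s \<in> I \<Longrightarrow> t \<in> Seg s \<Longrightarrow> seg_of t = s"
  using ex1_Seg seg_of by blast

definition report :: "'a \<Rightarrow> 'a set" where
  "report t = Msg (seg_of t)"

lemma report_eq_Msg_iff: "t \<in> T \<Longrightarrow> s \<in> I \<Longrightarrow> report t = Msg s \<longleftrightarrow> t \<in> Seg s"
  using seg_of[of t] seg_of_eq[of t s] Msg_inj by (auto simp: report_def inj_on_def)

lemma Seg_subset_T: "s \<in> I \<Longrightarrow> Seg s \<subseteq> T"
  using Seg_subset_Msg Msg_closed_convex(1) by blast

lemma report_level_set: "s \<in> I \<Longrightarrow> {t \<in> T. report t = Msg s} = Seg s"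
  using report_eq_Msg_iff Seg_subset_T by blast

text \<open>Since \<open>v\<close> is only lower semicontinuous, its supremum over \<open>M\<close> need not be attained; a type
  in the highest segment that meets \<open>M\<close> deters deviations just as well.\<close>

lemma exists_skeptical_type:
  assumes "M \<subseteq> T" "M \<noteq> {}"
  shows "\<exists>r\<in>M. \<forall>t\<in>M. price (seg_of t) \<le> v r"
proof -
  \<comment> \<open>\<open>enat\<close> is well-ordered, so a smallest segment index occurs in
    \<open>M\<close>; prices fall with the index, so this is the highest segment met.\<close>
  have "(LEAST s. s \<in> seg_of ` M) \<in> seg_of ` M"
    using assms(2) LeastI[of "\<lambda>s. s \<in> seg_of ` M"] by blast
  then obtain r where r: "r \<in> M" and "seg_of r = (LEAST s. s \<in> seg_of ` M)"
    by (metis imageE)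
  then have least: "seg_of r \<le> seg_of t" if "t \<in> M" for t
    using that by (simp add: Least_le)
  have "price (seg_of t) \<le> v r" if "t \<in> M" for t
    using price_antimono[OF least[OF that]] price_le_valuation[of "seg_of r" r] seg_of[of r]
      r assms(1) by fastforce
  then show ?thesis
    using r by blast
qed

definition skeptical_type :: "'a set \<Rightarrow> 'a" where
  "skeptical_type M = (SOME r. r \<in> M \<and> (\<forall>t\<in>M. price (seg_of t) \<le> v r))"

lemma skeptical_type:
  assumes "M \<in> msgs t"
  shows "skeptical_type M \<in> M" "\<And>t. t \<in> M \<Longrightarrow> price (seg_of t) \<le> v (skeptical_type M)"
proof -
  have "M \<subseteq> T" "M \<noteq> {}"
    using assms by (auto simp: rich_evidence_def)
  then have "\<exists>r. r \<in> M \<and> (\<forall>t\<in>M. price (seg_of t) \<le> v r)"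
    using exists_skeptical_type by blast
  from someI_ex[OF this] show "skeptical_type M \<in> M"
      "\<And>t. t \<in> M \<Longrightarrow> price (seg_of t) \<le> v (skeptical_type M)"
    by (auto simp: skeptical_type_def)
qed

text \<open>The term \<open>the_inv_into I Msg M\<close> is the segment index that \<open>M\<close>
  reveals. Any other message is off path and answered with the full valuation of the suspected type,
  who is indifferent and buys.\<close>

definition pricing :: "'a set \<Rightarrow> real" where
  "pricing M = (if M \<in> Msg ` I then price (the_inv_into I Msg M) else v (skeptical_type M))"

definition purchase :: "'a \<Rightarrow> 'a set \<Rightarrow> real \<Rightarrow> bool" where
  "purchase t M q \<longleftrightarrow> q \<le> v t"

text \<open>\<open>uniform_measure\<close> on a segment is \<open>\<mu>\<close> conditioned on it.
  The index \<open>\<infinity>\<close> is left out because its segment is null; its message gets a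
  point belief, like an off-path one.\<close>

definition belief :: "'a set \<Rightarrow> 'a measure" where
  "belief M = (if M \<in> Msg ` (I - {\<infinity>}) then uniform_measure \<mu> (Seg (the_inv_into I Msg M))
     else return \<mu> (skeptical_type M))"

lemma pricing_Msg: "s \<in> I \<Longrightarrow> pricing (Msg s) = price s"
  by (simp add: pricing_def the_inv_into_f_f[OF Msg_inj])

lemma senders_eq: "M \<in> msgs t \<Longrightarrow> senders T msgs M = M"
  by (auto simp: senders_def rich_evidence_def)

lemma Seg_positive:
  assumes "vlo < p k"
  shows "Seg (enat (Suc k)) \<in> sets \<mu>"
    and "measure \<mu> (Seg (enat (Suc k))) = F (p k) - F (p (Suc k))"
    and "0 < measure \<mu> (Seg (enat (Suc k)))"
  using measure_interval[OF p_Suc_le, of k] p_Suc_step(3)[OF assms]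
  by auto

text \<open>Two cases suffice because \<open>Msg \<infinity>\<close> behaves like an off-path
  message: all its members have valuation \<open>vlo\<close>, so its price is also the valuation of
  the suspected type.\<close>

lemma belief_cases:
  assumes "M \<in> msgs t"
  obtains
    (segment) k where "M = Msg (enat (Suc k))" "enat (Suc k) \<in> I" "vlo < p k"
      "belief M = uniform_measure \<mu> (Seg (enat (Suc k)))" "pricing M = p (Suc k)"
  | (point) "M \<notin> Msg ` (I - {\<infinity>})" "belief M = return \<mu> (skeptical_type M)"
      "pricing M = v (skeptical_type M)"
proof (cases "M \<in> Msg ` (I - {\<infinity>})")
  case True
  then obtain s where s: "s \<in> I" "s \<noteq> \<infinity>" "M = Msg s"
    by blast
  then obtain k where k: "s = enat (Suc k)" "vlo < p k"
    using I_cases by metis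
  have "belief M = uniform_measure \<mu> (Seg s)"
    using True s by (simp add: belief_def the_inv_into_f_f[OF Msg_inj])
  moreover have "pricing M = p (Suc k)"
    using s k pricing_Msg[of s] by simp
  ultimately show thesis
    using segment[of k] s k by metis
next
  case not_segment: False
  have "pricing M = v (skeptical_type M)"
  proof (cases "M = Msg \<infinity>")
    case True
    then have "v (skeptical_type M) = vlo"
      using skeptical_type(1)[OF assms] by simp
    then show ?thesis
      using True pricing_Msg[OF infinity_in_I] by simp
  next
    case neq: False
    then have "M \<notin> Msg ` I"
      using not_segment by blast
    then show ?thesis
      by (simp add: pricing_def)
  qed
  then show thesis
    using point not_segment by (simp add: belief_def)
qed

text \<open>The constraint that deters every deviation: after a segment message it comes from the
  order of the segments, after a point belief from the choice of the suspected type.\<close>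

lemma price_le_pricing:
  assumes "M \<in> msgs t" "t \<in> T"
  shows "price (seg_of t) \<le> pricing M"
proof -
  have t: "t \<in> M"
    using assms(1) by (simp add: rich_evidence_def)
  show ?thesis
    using assms(1)
  proof (cases rule: belief_cases)
    case (segment k)
    then show ?thesis
      using Seg_Msg_price_le[of "seg_of t" "enat (Suc k)" t] seg_of[OF assms(2)] t
      by simp
  next
    case point
    then show ?thesis
      using skeptical_type(2)[OF assms(1) t] by simp
  qed
qed

section \<open>Sequential rationality of consumer and seller\<close>

lemma report_in_msgs: "t \<in> T \<Longrightarrow> report t \<in> msgs t"
  using seg_of[of t] Seg_subset_Msg Msg_closed_convex
  by (auto simp: report_def rich_evidence_def)

lemma report_payoff:
  assumes "t \<in> T"
  shows "reporting_payoff v pricing purchase t (report t) = v t - price (seg_of t)"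
  using seg_of[OF assms] price_le_valuation[of "seg_of t" t]
  by (simp add: reporting_payoff_def consumer_payoff_def purchase_def report_def pricing_Msg)

lemma reporting_optimal: "optimal_reporting T v msgs report pricing purchase"
  unfolding optimal_reporting_def
proof (intro ballI conjI)
  fix t M assume t: "t \<in> T" and M: "M \<in> msgs t"
  have "reporting_payoff v pricing purchase t M = max (v t - pricing M) 0"
    by (simp add: reporting_payoff_def consumer_payoff_def purchase_def)
  \<comment> \<open>Both terms of the maximum are bounded by \<open>v t - price (seg_of t)\<close>:
    the price after \<open>M\<close> is no lower, and the own price is at most
    \<open>v t\<close>.\<close>
  then show "reporting_payoff v pricing purchase t M \<le> reporting_payoff v pricing purchase t (report t)"
    using price_le_pricing[OF M t] seg_of[OF t] price_le_valuation[of "seg_of t" t]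
    by (simp add: report_payoff[OF t])
qed (simp add: report_in_msgs)

lemma purchase_optimal: "optimal_purchase T v msgs purchase"
  by (auto simp: optimal_purchase_def consumer_payoff_def purchase_def)

lemma sets_T: "T \<in> sets \<mu>"
proof -
  have "T = {t \<in> T. v t \<le> vhi}"
    using v_bounds by auto
  then show ?thesis
    using sublevel_sets by metis
qed

text \<open>Measurability is available for sublevel sets, so the strict sublevel set is written as a
  countable union of them and removed from \<open>T\<close>.\<close>

lemma sets_purchasers: "{t \<in> T. x \<le> v t} \<in> sets \<mu>"
proof -
  have "{t \<in> T. x \<le> v t} = T - (\<Union>n. {t \<in> T. v t \<le> x - 1 / real (Suc n)})"
  proof (intro equalityI subsetI)
    fix t assume t: "t \<in> T - (\<Union>n. {t \<in> T. v t \<le> x - 1 / real (Suc n)})"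
    have "x \<le> v t"
    proof (rule ccontr)
      assume "\<not> x \<le> v t"
      then obtain n where "1 / real (Suc n) < x - v t"
        using nat_approx_posE[of "x - v t"] by auto
      then show False
        using t by (auto dest!: spec[of _ n])
    qed
    then show "t \<in> {t \<in> T. x \<le> v t}"
      using t by simp
  next
    fix t assume t: "t \<in> {t \<in> T. x \<le> v t}"
    have "\<not> v t \<le> x - 1 / real (Suc n)" for n
    proof -
      have "0 < 1 / real (Suc n)"
        by simp
      moreover have "x \<le> v t"
        using t by simp
      ultimately show ?thesis
        by linarith
    qed
    then show "t \<in> T - (\<Union>n. {t \<in> T. v t \<le> x - 1 / real (Suc n)})"
      using t by simp
  qed
  also have "\<dots> \<in> sets \<mu>"
    using sets_T by auto
  finally show ?thesis .
qed

lemma pricing_nonneg: "M \<in> msgs t \<Longrightarrow> t \<in> T \<Longrightarrow> 0 \<le> pricing M"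
  using price_le_pricing[of M t] price_ge[of "seg_of t"] vlo_nonneg by simp

lemma sets_message: "M \<in> msgs t \<Longrightarrow> M \<in> sets \<mu>"
  by (simp add: rich_evidence_def sets_mu borel_closed)

lemma message_subset: "M \<in> msgs t \<Longrightarrow> M \<subseteq> T"
  by (simp add: rich_evidence_def)

lemma revenue_point:
  assumes "M \<in> msgs t" and "belief M = return \<mu> r" and "r \<in> M"
  shows "expected_revenue T msgs purchase belief M q = (if q \<le> v r then q else 0)"
proof -
  have "{t \<in> M. q \<le> v t} = M \<inter> {t \<in> T. q \<le> v t}"
    using message_subset[OF assms(1)] by auto
  then have "{t \<in> M. q \<le> v t} \<in> sets \<mu>"
    using sets_message[OF assms(1)] sets_purchasers by simp
  then show ?thesis
    using assms by (simp add: expected_revenue_def senders_eq purchase_def measure_return)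
qed

text \<open>The fraction is the conditional demand. With \<open>max\<close>, one formula serves
  prices below the segment, where everyone in it buys, and prices inside it.\<close>

lemma revenue_segment:
  assumes M: "Msg (enat (Suc k)) \<in> msgs t" and k: "vlo < p k"
    and b: "belief (Msg (enat (Suc k))) = uniform_measure \<mu> (Seg (enat (Suc k)))"
  shows "expected_revenue T msgs purchase belief (Msg (enat (Suc k))) q =
    q * (measure \<mu> {t \<in> T. max q (p (Suc k)) \<le> v t \<and> p (Suc k) < v t \<and> v t \<le> p k} /
      (F (p k) - F (p (Suc k))))"
proof -
  let ?M = "Msg (enat (Suc k))" and ?S = "Seg (enat (Suc k))"
  have "{t \<in> ?M. q \<le> v t} = ?M \<inter> {t \<in> T. q \<le> v t}"
    by auto
  then have "{t \<in> ?M. q \<le> v t} \<in> sets \<mu>"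
    using sets_message[OF M] sets_purchasers by simp
  moreover have "?S \<inter> {t \<in> ?M. q \<le> v t} =
      {t \<in> T. max q (p (Suc k)) \<le> v t \<and> p (Suc k) < v t \<and> v t \<le> p k}"
    by auto
  ultimately show ?thesis
    using Seg_positive(2,3)[OF k] unfolding expected_revenue_def senders_eq[OF M] b purchase_def
    by (subst measure_uniform_measure) (auto simp: emeasure_eq_measure simp del: Seg_simps Msg_simps greedy_seq.simps)
qed

lemma pricing_optimal: "optimal_pricing T msgs pricing purchase belief"
  unfolding optimal_pricing_def
proof (intro ballI conjI allI impI)
  fix M assume "M \<in> (\<Union>t\<in>T. msgs t)"
  then obtain t where t: "t \<in> T" "M \<in> msgs t"
    by blast
  show "0 \<le> pricing M"
    using pricing_nonneg t by blast
  fix q :: real assume q: "0 \<le> q"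
  show "expected_revenue T msgs purchase belief M q
    \<le> expected_revenue T msgs purchase belief M (pricing M)"
    using t(2)
  proof (cases rule: belief_cases)
    case (segment k)
    note rev = revenue_segment[OF t(2)[unfolded segment(1)] segment(3) segment(4)[unfolded segment(1)]]
    let ?D = "F (p k) - F (p (Suc k))"
    have D: "0 < ?D"
      using p_Suc_step(3)[OF segment(3)] by simp
    have seg: "measure \<mu> {t \<in> T. p (Suc k) < v t \<and> v t \<le> p k} = ?D"
      using p_Suc_le by (rule measure_interval)
    then have "measure \<mu> {t \<in> T. p (Suc k) \<le> v t \<and> p (Suc k) < v t \<and> v t \<le> p k} = ?D"
      by (metis (mono_tags, lifting) Collect_cong less_imp_le)
    then have opt: "expected_revenue T msgs purchase belief M (pricing M) = p (Suc k)"
      using D unfolding segment(1) rev segment(5)[unfolded segment(1)] by simp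
    let ?A = "{t \<in> T. max q (p (Suc k)) \<le> v t \<and> p (Suc k) < v t \<and> v t \<le> p k}"
    \<comment> \<open>Below the segment the seller only gives up price, inside it the greedy choice
      of \<open>p (Suc k)\<close> applies, above it nobody buys.\<close>
    have "q * measure \<mu> ?A \<le> p (Suc k) * ?D"
    proof (cases "q \<le> p (Suc k)")
      case True
      have "measure \<mu> ?A \<le> ?D"
        unfolding seg[symmetric] using p_Suc_le
        by (intro finite_measure_mono measure_interval(1)) auto
      from True this show ?thesis
        by (rule mult_mono) (use q True in simp_all)
    next
      case False
      show ?thesis
      proof (cases "q \<le> p k")
        case True
        have "?A = {t \<in> T. q \<le> v t \<and> v t \<le> p k}"
          using False by auto
        then have "q * measure \<mu> ?A \<le> q * (F (p k) - F q)"
          using measure_interval_closed_le[OF True] q by (simp add: mult_left_mono)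
        also have "\<dots> \<le> p (Suc k) * ?D"
          using p_Suc_step(4)[OF segment(3) q] .
        finally show ?thesis .
      next
        case outside: False
        then have "?A = {}"
          by auto
        then have "measure \<mu> ?A = 0"
          by (metis measure_empty)
        then show ?thesis
          using D p_ge[of "Suc k"] vlo_nonneg by simp
      qed
    qed
    then have "q * (measure \<mu> ?A / ?D) \<le> p (Suc k)"
      using D by (simp add: pos_divide_le_eq)
    then show ?thesis
      unfolding opt unfolding segment(1) rev .
  next
    case point
    \<comment> \<open>Against a point belief, prices up to the valuation earn themselves and higher
      ones earn 0, so a nonnegative valuation is itself an optimal price.\<close>
    have "0 \<le> v (skeptical_type M)"
      using pricing_nonneg[OF t(2,1)] point by simp
    then show ?thesis
      using revenue_point[OF t(2) point(2) skeptical_type(1)[OF t(2)]] point(3) by simp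
  qed
qed

section \<open>Beliefs: evidence and Bayes' rule\<close>

lemma beliefs_evidence: "beliefs_respect_evidence \<mu> T msgs belief"
  unfolding beliefs_respect_evidence_def
proof (intro ballI)
  fix M assume "M \<in> (\<Union>t\<in>T. msgs t)"
  then obtain t where t: "t \<in> T" "M \<in> msgs t"
    by blast
  show "prob_space (belief M) \<and> sets (belief M) = sets \<mu> \<and>
      (AE t in belief M. t \<in> senders T msgs M)"
    unfolding senders_eq[OF t(2)] using t(2)
  proof (cases rule: belief_cases)
    case (segment k)
    have "AE t in uniform_measure \<mu> (Seg (enat (Suc k))). t \<in> Msg (enat (Suc k))"
      using Seg_positive(1)[OF segment(3)] Seg_subset_Msg[OF segment(2)]
      by (intro AE_uniform_measureI) auto
    then show "prob_space (belief M) \<and> sets (belief M) = sets \<mu> \<and> (AE t in belief M. t \<in> M)"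
      using Seg_positive(3)[OF segment(3)] unfolding segment(4) unfolding segment(1)
      by (auto simp: emeasure_eq_measure simp del: Seg_simps Msg_simps intro!: prob_space_uniform_measure)
  next
    case point
    have "Measurable.pred \<mu> (\<lambda>t. t \<in> M)"
      using sets_message[OF t(2)] by simp
    then show "prob_space (belief M) \<and> sets (belief M) = sets \<mu> \<and> (AE t in belief M. t \<in> M)"
      using skeptical_type(1)[OF t(2)] unfolding point(2) by (simp add: prob_space_return AE_return)
  qed
qed

text \<open>A finite segment is exactly the set of senders of its message, so the belief is the
  conditional law. The only other message sent is \<open>Msg \<infinity>\<close>, whose senders are
  null; there the belief just has to be concentrated on them.\<close>

lemma beliefs_bayes: "beliefs_bayesian \<mu> T report belief"
  unfolding beliefs_bayesian_def
proof (intro ballI)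
  fix M assume "M \<in> report ` T"
  then obtain t where t: "t \<in> T" "M = report t"
    by blast
  have M: "M \<in> msgs t"
    using report_in_msgs t by simp
  have "seg_of t \<in> I"
    using seg_of[OF t(1)] by simp
  let ?L = "{t \<in> T. report t = M}"
  show "(AE t in belief M. t \<in> T \<and> report t = M) \<and>
      (0 < measure \<mu> ?L \<longrightarrow>
        (\<forall>A\<in>sets \<mu>. measure (belief M) A = measure \<mu> (A \<inter> ?L) / measure \<mu> ?L))"
    using M
  proof (cases rule: belief_cases)
    case (segment k)
    have L: "?L = Seg (enat (Suc k))"
      unfolding segment(1) using segment(2) by (rule report_level_set)
    have "AE t in uniform_measure \<mu> ?L. t \<in> ?L"
      using Seg_positive(1)[OF segment(3)] unfolding L by (intro AE_uniform_measureI) auto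
    moreover have "measure (uniform_measure \<mu> ?L) A = measure \<mu> (A \<inter> ?L) / measure \<mu> ?L"
      if "A \<in> sets \<mu>" for A
      using that Seg_positive(3)[OF segment(3)] unfolding L
      by (subst measure_uniform_measure) (auto simp: emeasure_eq_measure Int_commute simp del: Seg_simps)
    moreover have b: "belief M = uniform_measure \<mu> ?L"
      unfolding L by (rule segment(4))
    ultimately show ?thesis
      unfolding b mem_Collect_eq by blast
  next
    case point
    have "M = Msg (seg_of t)"
      using t(2) by (simp only: report_def)
    then have "seg_of t = \<infinity>"
      using point(1) \<open>seg_of t \<in> I\<close> by blast
    then have s: "M = Msg \<infinity>"
      using \<open>M = Msg (seg_of t)\<close> by (simp only:)
    have L: "?L = Seg \<infinity>"
      unfolding s using infinity_in_I by (rule report_level_set)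
    have "Measurable.pred \<mu> (\<lambda>t. t \<in> Seg \<infinity>)"
      using null_setsD2[OF Seg_null] by (simp del: Seg_simps)
    moreover have "skeptical_type M \<in> Seg \<infinity>"
      using skeptical_type(1)[OF M] s by simp
    ultimately have "AE t in belief M. t \<in> ?L"
      unfolding point(2) L by (simp add: AE_return del: Seg_simps)
    moreover have "measure \<mu> ?L = 0"
      unfolding L using Seg_null by (simp add: measure_eq_0_null_sets del: Seg_simps)
    ultimately show ?thesis
      by simp
  qed
qed

lemma equilibrium: "perfect_bayesian_equilibrium \<mu> T v msgs report pricing purchase belief"
  unfolding perfect_bayesian_equilibrium_def
  using reporting_optimal pricing_optimal purchase_optimal beliefs_evidence beliefs_bayes by blast

section \<open>Comparison with the benchmark\<close>

lemma F_vhi: "F vhi = 1"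
proof -
  have "{t \<in> T. v t \<le> vhi} = T"
    using v_bounds by auto
  then show ?thesis
    using measure_sublevel[of vhi] AE_T prob_eq_1[OF sets_T] by simp
qed

text \<open>As \<open>F vhi = 1\<close>, the first greedy objective coincides with the benchmark
  revenue \<open>x * (1 - F x)\<close>.\<close>

lemma benchmark_price_eq: "benchmark_price F = p 1"
  using vlo_less_vhi by (simp add: benchmark_price_def F_vhi p_Suc[of 0, simplified])

text \<open>Every segment price is at most \<open>p 1\<close>, so nobody loses. Outside the null
  segment every type keeps a positive surplus, a strict gain unless the benchmark surplus was
  already positive.\<close>

lemma improving:
  "pareto_improving \<mu> T v (benchmark_price F) (\<lambda>t. reporting_payoff v pricing purchase t (report t))"
  unfolding pareto_improving_def benchmark_price_eq
proof (intro conjI ballI)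
  fix t assume t: "t \<in> T"
  have "price (seg_of t) \<le> p 1"
    using seg_of[OF t] p_ge[of 1] p_antimono[of 1]
    by (auto elim!: I_cases)
  then show "max (v t - p 1) 0 \<le> reporting_payoff v pricing purchase t (report t)"
    using seg_of[OF t] price_le_valuation[of "seg_of t" t] by (simp add: report_payoff[OF t])
next
  have "AE t in \<mu>. t \<notin> Seg \<infinity>"
    using Seg_null by (rule AE_not_in)
  then show "AE t in \<mu>. t \<in> T \<longrightarrow>
      max (v t - p 1) 0 < reporting_payoff v pricing purchase t (report t) \<or> 0 < max (v t - p 1) 0"
  proof (eventually_elim, intro impI)
    fix t assume t: "t \<notin> Seg \<infinity>" "t \<in> T"
    then have "seg_of t \<noteq> \<infinity>"
      using seg_of by metis
    then have "price (seg_of t) < v t"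
      using seg_of[OF t(2)] by (auto elim!: I_cases)
    then show "max (v t - p 1) 0 < reporting_payoff v pricing purchase t (report t) \<or>
        0 < max (v t - p 1) 0"
      by (auto simp: report_payoff[OF t(2)])
  qed
qed

lemma greedy_report: "greedy_reporting T v F vlo vhi report"
  unfolding greedy_reporting_def using ex1_Seg report_eq_Msg_iff Seg_subset_T by blast

lemma segment_sales: "t \<in> T \<Longrightarrow> s \<in> I \<Longrightarrow> report t = Msg s \<Longrightarrow> purchase t (Msg s) (price s)"
  using report_eq_Msg_iff price_le_valuation by (simp add: purchase_def)

end

section \<open>Deriving the standing assumptions from the primitives\<close>

theorem proposition2:
  fixes T :: "'a::euclidean_space set"
    and \<mu> :: "'a measure"
    and v :: "'a \<Rightarrow> real"
    and F :: "real \<Rightarrow> real"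
    and vlo vhi :: real
  assumes "prob_space \<mu>" and "sets \<mu> = sets borel"
    and "measure_support \<mu> = T" and "convex T" and "compact T"
    and "\<forall>t\<in>T. 0 \<le> v t"
    and "quasiconvex_on T v"
    and lower_semicontinuous: "\<forall>c. closed {t \<in> T. v t \<le> c}"
    and "F = valuation_cdf \<mu> T v"
    and "continuous_on UNIV F"
    and "vlo \<in> cdf_support F" and "vhi \<in> cdf_support F"
    and "\<forall>t\<in>T. vlo \<le> v t \<and> v t \<le> vhi"
    and "F vlo = 0"
  shows "\<exists>\<sigma> \<pi> buy \<beta>.
      perfect_bayesian_equilibrium \<mu> T v (rich_evidence T) \<sigma> \<pi> buy \<beta> \<and>
      pareto_improving \<mu> T v (benchmark_price F) (\<lambda>t. reporting_payoff v \<pi> buy t (\<sigma> t)) \<and>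
      greedy_reporting T v F vlo vhi \<sigma> \<and>
      (\<forall>s\<in>greedy_indices F vlo vhi.
         \<pi> (greedy_message T v F vlo vhi s) = greedy_price F vlo vhi s \<and>
         (\<forall>t\<in>T. \<sigma> t = greedy_message T v F vlo vhi s \<longrightarrow>
            buy t (greedy_message T v F vlo vhi s) (greedy_price F vlo vhi s)))"
proof -
  interpret prob_space \<mu>
    by fact
  note F_eq = \<open>F = valuation_cdf \<mu> T v\<close> and sets_mu = \<open>sets \<mu> = sets borel\<close>
  have bounds: "vlo \<le> v t \<and> v t \<le> vhi" if "t \<in> T" for t
    using that assms(13) by blast
  have sublevel: "{t \<in> T. v t \<le> c} \<in> sets \<mu>" for c
    using lower_semicontinuous sets_mu by (simp add: borel_closed)
  have F_nonneg: "0 \<le> F x" for x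
    by (simp add: F_eq valuation_cdf_def)
  have F_mono: "mono F"
    unfolding F_eq valuation_cdf_def using sublevel
    by (intro monoI finite_measure_mono) auto
  have F_below: "F x = 0" if "x \<le> vlo" for x
    using that monoD[OF F_mono, of x vlo] \<open>F vlo = 0\<close> F_nonneg[of x] by simp
  \<comment> \<open>The support condition at \<open>vlo\<close> is taken with radius
    \<open>x - vlo\<close>; at the left end \<open>F\<close> is 0.\<close>
  have F_pos: "0 < F x" if "vlo < x" for x
    using assms(11) that F_below[of "vlo - (x - vlo)"] unfolding cdf_support_def
    by (auto dest!: spec[of _ "x - vlo"])
  have AE_T: "AE t in \<mu>. t \<in> T"
    using null_set_Compl_measure_support[OF sets_mu] \<open>measure_support \<mu> = T\<close> AE_not_in by fastforce
  have "T \<noteq> {}"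
    using AE_T AE_False by auto
  then have "vlo \<le> vhi"
    using bounds by force
  have T: "T = {t \<in> T. v t \<le> vhi}"
    using bounds by auto
  have "F vhi = 1"
    using AE_T sublevel[of vhi] T by (simp add: F_eq valuation_cdf_def prob_eq_1)
  then have "vlo < vhi"
    using \<open>F vlo = 0\<close> \<open>vlo \<le> vhi\<close> by (metis less_eq_real_def zero_neq_one)
  have "0 \<le> vlo"
  proof (rule ccontr)
    \<comment> \<open>For negative \<open>vlo\<close> the point \<open>vlo / 2\<close> lies strictly
      between \<open>vlo\<close> and 0: \<open>F\<close> is positive there, yet no type has a
      negative valuation.\<close>
    assume "\<not> 0 \<le> vlo"
    then have "0 < F (vlo / 2)"
      using F_pos by simp
    moreover have "{t \<in> T. v t \<le> vlo / 2} = {}"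
      using \<open>\<not> 0 \<le> vlo\<close> assms(6) by force
    ultimately show False
      unfolding F_eq valuation_cdf_def by (metis less_irrefl measure_empty)
  qed
  interpret disclosure_game F vlo vhi T \<mu> v
    using F_mono F_pos F_nonneg AE_T bounds \<open>0 \<le> vlo\<close> \<open>vlo < vhi\<close> assms
      quasiconvex_on_convex_sublevel
    by unfold_locales auto
  show ?thesis
    using equilibrium improving greedy_report pricing_Msg segment_sales by blast
qed

end
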